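(* Let $\mathbf{q}=(q_0,\dots,q_n)$ be well-formed positive integer weights, $q=\operatorname{lcm}(q_0,\dots,q_n)\geq 2$, and $n_i = q/q_i$. Then for every prime $\ell \mid q$ there exist indices $i \neq j$ with $\ell \mid \gcd(n_i, n_j)$. In particular the exponents $n_i$ are never pairwise coprime; the map $\phi : \mathbb{WP}^n_{\mathbf{q}}(\mathbb{Q})\to\mathbb{P}^n(\mathbb{Q})$, $[x_0:\dots:x_n]\mapsto[x_0^{n_0}:\dots:x_n^{n_n}]$, is not surjective; and at every rational prime $p$ the liftability condition "$v_p(y_i) \equiv v_p(y_j) \pmod{\gcd(n_i, n_j)}$ for all $i,j$" on points $y\in\mathbb{P}^n(\mathbb{Q})$ with nonzero coordinates is nontrivial (some modulus $\gcd(n_i,n_j)$ with $i\ne j$ exceeds $1$).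
   Context: The weights $\mathbf{q}$ are well-formed if $\gcd(q_0,\dots,\widehat{q_i},\dots,q_n) = 1$ (omit $q_i$) for each $i$. $\mathbb{WP}^n_{\mathbf{q}}(\overline{\mathbb{Q}})$ is the set of nonzero tuples $\mathbf{x} \in \overline{\mathbb{Q}}^{n+1}$ modulo $\mathbf{x} \sim (\lambda^{q_0}x_0, \dots, \lambda^{q_n}x_n)$, $\lambda \in \overline{\mathbb{Q}}^{\times}$; $\mathbb{WP}^n_{\mathbf{q}}(\mathbb{Q})$ is the subset of classes admitting a representative in $\mathbb{Q}^{n+1}$. The displayed congruence condition, imposed at all primes $p$, is one of the two conditions (the other being a sign condition) characterizing when $y$ has a preimage in $\mathbb{WP}^n_{\mathbf{q}}(\mathbb{Q})$ under $\phi$. *)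

theory Defs
  imports
    "HOL-Analysis.Finite_Cartesian_Product"
    "HOL-Algebra.Algebraic_Closure_Type"
    "HOL-Number_Theory.Cong"
begin

no_notation fps_nth (infixl "$" 75)

text \<open>
  The index set \<open>{0, \<dots>, n}\<close> is an arbitrary finite type \<open>'i\<close> (so \<open>n = CARD('i) - 1\<close>), and
  \<open>(n + 1)\<close>-tuples over \<open>K\<close> are elements of \<open>K ^ 'i\<close>.
\<close>

type_synonym Qbar = "rat alg_closure"

text \<open>For \<open>CARD('i) = 1\<close> the gcd is that of the empty family, which is \<open>0\<close>.\<close>

definition well_formed :: "('i::finite \<Rightarrow> nat) \<Rightarrow> bool" where
  "well_formed q \<longleftrightarrow> (\<forall>i. (GCD j\<in>UNIV - {i}. q j) = 1)"

definition weights_lcm :: "('i::finite \<Rightarrow> nat) \<Rightarrow> nat" where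
  "weights_lcm q = (LCM i\<in>UNIV. q i)"

definition exponent :: "('i::finite \<Rightarrow> nat) \<Rightarrow> 'i \<Rightarrow> nat" where
  "exponent q i = weights_lcm q div q i"

definition wproj_rel :: "('i::finite \<Rightarrow> nat) \<Rightarrow> (Qbar ^ 'i) rel" where
  "wproj_rel q = {(x, y). x \<noteq> 0 \<and> y \<noteq> 0 \<and> (\<exists>c. c \<noteq> 0 \<and> y = (\<chi> i. c ^ q i * x $ i))}"

definition wproj_space :: "('i::finite \<Rightarrow> nat) \<Rightarrow> (Qbar ^ 'i) set set" where
  "wproj_space q = (UNIV - {0}) // wproj_rel q"

definition of_rat_vec :: "rat ^ 'i \<Rightarrow> Qbar ^ 'i" where
  "of_rat_vec x = (\<chi> i. of_rat (x $ i))"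

definition wproj_space_rat :: "('i::finite \<Rightarrow> nat) \<Rightarrow> (Qbar ^ 'i) set set" where
  "wproj_space_rat q = {P \<in> wproj_space q. \<exists>x. of_rat_vec x \<in> P}"

definition proj_rel :: "(rat ^ 'i::finite) rel" where
  "proj_rel = {(x, y). x \<noteq> 0 \<and> y \<noteq> 0 \<and> (\<exists>c. c \<noteq> 0 \<and> y = c *s x)}"

definition proj_space_rat :: "(rat ^ 'i::finite) set set" where
  "proj_space_rat = (UNIV - {0}) // proj_rel"

definition nonzero_coords :: "(rat ^ 'i::finite) set \<Rightarrow> bool" where
  "nonzero_coords Y \<longleftrightarrow> (\<forall>y\<in>Y. \<forall>i. y $ i \<noteq> 0)"

definition power_vec :: "('i::finite \<Rightarrow> nat) \<Rightarrow> rat ^ 'i \<Rightarrow> rat ^ 'i" where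
  "power_vec q x = (\<chi> i. (x $ i) ^ exponent q i)"

text \<open>
  The union below ranges over the rational representatives \<open>x\<close> of \<open>P\<close>; they all contribute the
  same class, see \<open>wproj_to_proj_class\<close>.
\<close>

definition wproj_to_proj :: "('i::finite \<Rightarrow> nat) \<Rightarrow> (Qbar ^ 'i) set \<Rightarrow> (rat ^ 'i) set" where
  "wproj_to_proj q P = (\<Union>x\<in>{x. of_rat_vec x \<in> P}. proj_rel `` {power_vec q x})"

text \<open>Only used at nonzero rationals; the value at \<open>0\<close> is irrelevant.\<close>

definition rat_valuation :: "nat \<Rightarrow> rat \<Rightarrow> int" where
  "rat_valuation p r =
     (case quotient_of r of (a, b) \<Rightarrow>
        int (multiplicity (int p) a) - int (multiplicity (int p) b))"

text \<open>
  Quantifying over all representatives is the same as choosing one, see \<open>liftable_at_class\<close>.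
\<close>

definition liftable_at :: "('i::finite \<Rightarrow> nat) \<Rightarrow> nat \<Rightarrow> (rat ^ 'i) set \<Rightarrow> bool" where
  "liftable_at q p Y \<longleftrightarrow>
     (\<forall>y\<in>Y. \<forall>i j. [rat_valuation p (y $ i) = rat_valuation p (y $ j)]
                    (mod int (gcd (exponent q i) (exponent q j))))"

lemma equiv_wproj_rel: "equiv (UNIV - {0}) (wproj_rel q)"
proof (rule equivI)
  show "refl_on (UNIV - {0}) (wproj_rel q)"
    by (auto simp: refl_on_def wproj_rel_def vec_eq_iff intro!: exI[of _ 1])
  show "wproj_rel q \<subseteq> (UNIV - {0}) \<times> (UNIV - {0})"
    by (auto simp: wproj_rel_def)
  show "sym (wproj_rel q)"
  proof (rule symI)
    fix x y assume "(x, y) \<in> wproj_rel q"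
    then obtain c where c: "x \<noteq> 0" "y \<noteq> 0" "c \<noteq> 0" "y = (\<chi> i. c ^ q i * x $ i)"
      by (auto simp: wproj_rel_def)
    then have "x = (\<chi> i. inverse c ^ q i * y $ i)"
      by (simp add: vec_eq_iff power_inverse)
    moreover have "inverse c \<noteq> 0"
      using c by simp
    ultimately show "(y, x) \<in> wproj_rel q"
      using c(1,2) unfolding wproj_rel_def by blast
  qed
  show "trans (wproj_rel q)"
  proof (rule transI)
    fix x y z assume "(x, y) \<in> wproj_rel q" "(y, z) \<in> wproj_rel q"
    then obtain c d where cd: "x \<noteq> 0" "z \<noteq> 0" "c \<noteq> 0" "d \<noteq> 0"
      "y = (\<chi> i. c ^ q i * x $ i)" "z = (\<chi> i. d ^ q i * y $ i)"
      by (auto simp: wproj_rel_def)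
    then have "z = (\<chi> i. (d * c) ^ q i * x $ i)"
      by (simp add: vec_eq_iff power_mult_distrib)
    moreover have "d * c \<noteq> 0"
      using cd by simp
    ultimately show "(x, z) \<in> wproj_rel q"
      using cd(1,2) unfolding wproj_rel_def by blast
  qed
qed

lemma equiv_proj_rel: "equiv (UNIV - {0}) proj_rel"
proof (rule equivI)
  show "refl_on (UNIV - {0}) proj_rel"
    by (auto simp: refl_on_def proj_rel_def vec_eq_iff intro!: exI[of _ 1])
  show "proj_rel \<subseteq> (UNIV - {0}) \<times> (UNIV - {0})"
    by (auto simp: proj_rel_def)
  show "sym proj_rel"
  proof (rule symI)
    fix x y :: "rat ^ 'i" assume "(x, y) \<in> proj_rel"
    then obtain c where c: "x \<noteq> 0" "y \<noteq> 0" "c \<noteq> 0" "y = c *s x"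
      by (auto simp: proj_rel_def)
    then have "x = inverse c *s y"
      by (simp add: vec_eq_iff)
    moreover have "inverse c \<noteq> 0"
      using c by simp
    ultimately show "(y, x) \<in> proj_rel"
      using c(1,2) unfolding proj_rel_def by blast
  qed
  show "trans proj_rel"
  proof (rule transI)
    fix x y z :: "rat ^ 'i" assume "(x, y) \<in> proj_rel" "(y, z) \<in> proj_rel"
    then obtain c d where cd: "x \<noteq> 0" "z \<noteq> 0" "c \<noteq> 0" "d \<noteq> 0" "y = c *s x" "z = d *s y"
      by (auto simp: proj_rel_def)
    then have "z = (d * c) *s x"
      by (simp add: vec_eq_iff)
    moreover have "d * c \<noteq> 0"
      using cd by simp
    ultimately show "(x, z) \<in> proj_rel"
      using cd(1,2) unfolding proj_rel_def by blast
  qed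
qed

lemma of_rat_vec_eq_0_iff [simp]: "of_rat_vec x = 0 \<longleftrightarrow> x = 0"
  by (simp add: of_rat_vec_def vec_eq_iff)

lemma weight_mult_exponent: "q i * exponent q i = weights_lcm q"
proof -
  have "q i dvd weights_lcm q"
    unfolding weights_lcm_def by (rule dvd_Lcm) auto
  then show ?thesis
    by (simp add: exponent_def)
qed

lemma exponent_pos:
  fixes q :: "'i::finite \<Rightarrow> nat"
  assumes "\<forall>i. 0 < q i"
  shows "0 < exponent q i"
proof -
  have "0 \<notin> range q"
    using assms by (metis less_irrefl rangeE)
  then have "weights_lcm q \<noteq> 0"
    by (simp add: weights_lcm_def Lcm_0_iff)
  then show ?thesis
    using weight_mult_exponent[of q i] by (cases "exponent q i") auto
qed

lemma power_vec_nonzero: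
  assumes "\<forall>i. 0 < q i" "x \<noteq> 0"
  shows "power_vec q x \<noteq> 0"
  using assms exponent_pos[OF assms(1)] by (auto simp: power_vec_def vec_eq_iff)

lemma power_vec_respects:
  assumes q: "\<forall>i. 0 < q i" and xy: "(of_rat_vec x, of_rat_vec y) \<in> wproj_rel q"
  shows "(power_vec q x, power_vec q y) \<in> proj_rel"
proof -
  obtain c :: Qbar where c: "c \<noteq> 0" and nz: "x \<noteq> 0" "y \<noteq> 0"
    and y: "of_rat_vec y = (\<chi> i. c ^ q i * of_rat_vec x $ i)"
    using xy by (auto simp: wproj_rel_def)
  let ?U = "power_vec q x" and ?V = "power_vec q y"
  have eq: "of_rat (?V $ i) = c ^ weights_lcm q * of_rat (?U $ i)" for i
  proof -
    have "of_rat (y $ i) = c ^ q i * of_rat (x $ i)"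
      using y by (simp add: of_rat_vec_def vec_eq_iff)
    then show ?thesis
      by (simp add: power_vec_def of_rat_power power_mult_distrib
          flip: power_mult weight_mult_exponent[of q i])
  qed
  have XY: "?U \<noteq> 0" "?V \<noteq> 0"
    using q nz by (auto dest: power_vec_nonzero)
  then obtain k where k: "?U $ k \<noteq> 0"
    by (auto simp: vec_eq_iff)
  define r where "r = ?V $ k / ?U $ k"
  have r: "of_rat r = c ^ weights_lcm q"
    using eq[of k] k by (simp add: r_def of_rat_divide)
  then have "r \<noteq> 0"
    using c by (metis of_rat_0 power_not_zero)
  moreover have "?V $ i = r * ?U $ i" for i
  proof -
    have "(of_rat (?V $ i) :: Qbar) = of_rat (r * ?U $ i)"
      using eq[of i] r by (simp add: of_rat_mult)
    then show ?thesis
      by (simp only: of_rat_eq_iff)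
  qed
  then have "?V = r *s ?U"
    by (simp add: vec_eq_iff)
  ultimately show ?thesis
    using XY unfolding proj_rel_def by blast
qed

lemma wproj_to_proj_class:
  assumes q: "\<forall>i. 0 < q i" and P: "P \<in> wproj_space_rat q" and x: "of_rat_vec x \<in> P"
  shows "wproj_to_proj q P = proj_rel `` {power_vec q x}"
proof -
  have "proj_rel `` {power_vec q y} = proj_rel `` {power_vec q x}" if "of_rat_vec y \<in> P" for y
  proof (rule equiv_class_eq[OF equiv_proj_rel])
    have "P \<in> (UNIV - {0}) // wproj_rel q"
      using P by (simp add: wproj_space_rat_def wproj_space_def)
    then have "(of_rat_vec y, of_rat_vec x) \<in> wproj_rel q"
      using that x by (meson quotient_eq_iff[OF equiv_wproj_rel])
    then show "(power_vec q y, power_vec q x) \<in> proj_rel"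
      by (rule power_vec_respects[OF q])
  qed
  then show ?thesis
    unfolding wproj_to_proj_def using x by (intro UN_constant_eq) blast+
qed

lemma wproj_to_proj_in_proj_space_rat:
  assumes q: "\<forall>i. 0 < q i" and P: "P \<in> wproj_space_rat q"
  shows "wproj_to_proj q P \<in> proj_space_rat"
proof -
  obtain x where x: "of_rat_vec x \<in> P"
    using P by (auto simp: wproj_space_rat_def)
  have "P \<in> (UNIV - {0}) // wproj_rel q"
    using P by (simp add: wproj_space_rat_def wproj_space_def)
  then have "P \<subseteq> UNIV - {0}"
    using in_quotient_imp_subset[OF equiv_wproj_rel] by blast
  then have "of_rat_vec x \<noteq> 0"
    using x by blast
  then have "power_vec q x \<noteq> 0"
    using power_vec_nonzero[OF q] by simp
  then show ?thesis
    unfolding wproj_to_proj_class[OF q P x] proj_space_rat_def by (intro quotientI) simp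
qed

lemma rat_valuation_of_int_divide:
  assumes p: "prime p" and nz: "a \<noteq> 0" "b \<noteq> 0"
  shows "rat_valuation p (of_int a / of_int b) =
         int (multiplicity (int p) a) - int (multiplicity (int p) b)"
proof -
  obtain c d where cd: "quotient_of (of_int a / of_int b) = (c, d)"
    by (cases "quotient_of (of_int a / of_int b)")
  have d: "d > 0"
    using quotient_of_denom_pos[OF cd] .
  have "(of_int a / of_int b :: rat) = of_int c / of_int d"
    using quotient_of_div[OF cd] .
  then have "(of_int (a * d) :: rat) = of_int (c * b)"
    using nz d by (simp add: field_simps)
  then have eq: "a * d = c * b"
    by (simp only: of_int_eq_iff)
  have "c \<noteq> 0"
    using eq nz d by auto
  have pp: "prime_elem (int p)"
    using p by (intro prime_imp_prime_elem) simp
  have "multiplicity (int p) a + multiplicity (int p) d =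
        multiplicity (int p) c + multiplicity (int p) b"
    using arg_cong[OF eq, of "multiplicity (int p)"] nz d \<open>c \<noteq> 0\<close>
    by (simp add: prime_elem_multiplicity_mult_distrib[OF pp])
  then show ?thesis
    unfolding rat_valuation_def cd by simp
qed

lemma rat_valuation_mult:
  assumes p: "prime p" and nz: "r \<noteq> 0" "s \<noteq> 0"
  shows "rat_valuation p (r * s) = rat_valuation p r + rat_valuation p s"
proof -
  obtain a b where r: "r = of_int a / of_int b" "a \<noteq> 0" "b \<noteq> 0"
    using nz(1) by (cases r) (auto simp: Fract_of_int_quotient)
  obtain c d where s: "s = of_int c / of_int d" "c \<noteq> 0" "d \<noteq> 0"
    using nz(2) by (cases s) (auto simp: Fract_of_int_quotient)
  have rs: "r * s = of_int (a * c) / of_int (b * d)"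
    by (simp add: r s)
  have pp: "prime_elem (int p)"
    using p by (intro prime_imp_prime_elem) simp
  have "rat_valuation p (r * s) =
        int (multiplicity (int p) (a * c)) - int (multiplicity (int p) (b * d))"
    unfolding rs using r s by (intro rat_valuation_of_int_divide[OF p]) auto
  also have "\<dots> = rat_valuation p r + rat_valuation p s"
    using r s by (simp add: rat_valuation_of_int_divide[OF p]
        prime_elem_multiplicity_mult_distrib[OF pp])
  finally show ?thesis .
qed

lemma liftable_at_class:
  fixes y :: "rat ^ 'i::finite"
  assumes p: "prime p" and y: "\<forall>i. y $ i \<noteq> 0"
  shows "liftable_at q p (proj_rel `` {y}) \<longleftrightarrow>
         (\<forall>i j. [rat_valuation p (y $ i) = rat_valuation p (y $ j)]
                  (mod int (gcd (exponent q i) (exponent q j))))"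
    (is "_ \<longleftrightarrow> ?R y")
proof
  assume "liftable_at q p (proj_rel `` {y})"
  moreover have "y \<noteq> 0"
    using y by auto
  then have "y \<in> proj_rel `` {y}"
    by (intro equiv_class_self[OF equiv_proj_rel]) auto
  ultimately show "?R y"
    by (auto simp: liftable_at_def)
next
  assume R: "?R y"
  have "?R z" if "z \<in> proj_rel `` {y}" for z
  proof -
    obtain c where c: "c \<noteq> 0" "z = c *s y"
      using \<open>z \<in> proj_rel `` {y}\<close> by (auto simp: proj_rel_def)
    then have "rat_valuation p (z $ i) = rat_valuation p c + rat_valuation p (y $ i)" for i
      using y by (simp add: rat_valuation_mult[OF p])
    then show ?thesis
      using R by (simp add: cong_add_lcancel)
  qed
  then show "liftable_at q p (proj_rel `` {y})"
    unfolding liftable_at_def by blast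
qed

end

theory Submission
  imports Defs
begin

text \<open>
  Let \<open>\<ell>\<close> be a prime dividing \<open>lcm q\<close>. Well-formedness yields an index \<open>i\<close> with \<open>q\<^sub>i\<close> prime to \<open>\<ell>\<close>, and,
  applied with that \<open>i\<close> omitted, a second one \<open>j\<close>. As \<open>q\<^sub>i n\<^sub>i = lcm q\<close>, both \<open>n\<^sub>i\<close> and \<open>n\<^sub>j\<close> are divisible
  by \<open>\<ell>\<close>. Points in the image of \<open>\<phi>\<close> have representatives whose \<open>i\<close>-th valuation is a multiple of
  \<open>n\<^sub>i\<close>, so they are liftable at every prime \<open>p\<close>; the point with \<open>i\<close>-th coordinate \<open>p\<close> and all others
  \<open>1\<close> is not, since \<open>1 \<noteq> 0\<close> modulo \<open>gcd n\<^sub>i n\<^sub>j\<close>.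
\<close>

text \<open>A common divisor of the weights other than \<open>q k\<close> divides their gcd 1, hence
  is a unit. With a single index that gcd is 0, so well-formedness fails.\<close>

lemma well_formed_obtain_not_dvd:
  assumes "well_formed q" "\<not> is_unit l"
  obtains j where "j \<noteq> k" "\<not> l dvd q j"
proof -
  have "(GCD j\<in>UNIV - {k}. q j) = 1"
    using assms(1) by (simp add: well_formed_def)
  then have "\<not> (\<forall>j\<in>UNIV - {k}. l dvd q j)"
    using assms(2) by (metis Gcd_greatest imageE)
  then show thesis
    using that by blast
qed

lemma prime_dvd_exponent:
  assumes "prime l" "l dvd weights_lcm q" "\<not> l dvd q i"
  shows "l dvd exponent q i"
  using assms by (metis prime_dvd_mult_iff weight_mult_exponent)

lemma prime_dvd_gcd_exponents:
  assumes "well_formed q" and l: "prime l" "l dvd weights_lcm q"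
  obtains i j where "i \<noteq> j" "l dvd gcd (exponent q i) (exponent q j)"
proof -
  have l1: "\<not> is_unit l"
    using l(1) by auto
  \<comment> \<open>The omitted index is arbitrary here; only the second choice has to avoid
    \<open>i\<close>.\<close>
  obtain i where i: "\<not> l dvd q i"
    using well_formed_obtain_not_dvd[OF assms(1) l1] by metis
  obtain j where j: "j \<noteq> i" "\<not> l dvd q j"
    using well_formed_obtain_not_dvd[OF assms(1) l1] by metis
  show thesis
    using that[of i j] j i prime_dvd_exponent[OF l] by (metis gcd_greatest)
qed

lemma rat_valuation_1 [simp]: "rat_valuation p 1 = 0"
  by (simp add: rat_valuation_def)

lemma rat_valuation_self:
  assumes "prime p"
  shows "rat_valuation p (of_nat p) = 1"
  using rat_valuation_of_int_divide[OF assms, of "int p" 1] assms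
  by (simp add: prime_gt_0_nat multiplicity_prime)

lemma rat_valuation_power:
  assumes "prime p" "r \<noteq> 0"
  shows "rat_valuation p (r ^ n) = int n * rat_valuation p r"
  using assms by (induction n) (simp_all add: rat_valuation_mult algebra_simps)

text \<open>Necessity of the valuation condition. Nonzero coordinates keep
  \<open>rat_valuation\<close> away from its meaningless value at 0.\<close>

lemma liftable_at_wproj_to_proj:
  assumes q: "\<forall>i. 0 < q i" and p: "prime p" and P: "P \<in> wproj_space_rat q"
    and nz: "nonzero_coords (wproj_to_proj q P)"
  shows "liftable_at q p (wproj_to_proj q P)"
proof -
  obtain x where x: "of_rat_vec x \<in> P"
    using P by (auto simp: wproj_space_rat_def)
  have P_eq: "wproj_to_proj q P = proj_rel `` {power_vec q x}"
    by (rule wproj_to_proj_class[OF q P x])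
  have "of_rat_vec x \<noteq> 0"
    using P x in_quotient_imp_subset[OF equiv_wproj_rel]
    by (fastforce simp: wproj_space_rat_def wproj_space_def)
  then have "power_vec q x \<noteq> 0"
    using power_vec_nonzero[OF q] by simp
  then have "power_vec q x \<in> wproj_to_proj q P"
    unfolding P_eq by (intro equiv_class_self[OF equiv_proj_rel]) simp
  then have pv_nz: "\<forall>i. power_vec q x $ i \<noteq> 0"
    using nz by (simp add: nonzero_coords_def)
  \<comment> \<open>A positive exponent rules out \<open>0 ^ 0 = 1\<close>, which would hide a zero
    coordinate.\<close>
  then have x_nz: "x $ i \<noteq> 0" for i
    using exponent_pos[OF q, of i] by (auto simp: power_vec_def dest!: spec[of _ i])
  have val: "rat_valuation p (power_vec q x $ i) = int (exponent q i) * rat_valuation p (x $ i)" for i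
    by (simp add: power_vec_def rat_valuation_power[OF p x_nz])
  have cong_0: "[rat_valuation p (power_vec q x $ i) = 0] (mod int d)" if "d dvd exponent q i" for d i
    unfolding cong_0_iff val using that by (intro dvd_mult2) simp
  \<comment> \<open>Both sides vanish modulo the gcd, as it divides both exponents.\<close>
  have "[rat_valuation p (power_vec q x $ i) = rat_valuation p (power_vec q x $ j)]
          (mod int (gcd (exponent q i) (exponent q j)))" for i j
    by (rule cong_trans[OF cong_0 cong_sym[OF cong_0]]) (rule gcd_dvd1, rule gcd_dvd2)
  then show ?thesis
    unfolding P_eq liftable_at_class[OF p pv_nz] by blast
qed

lemma exists_not_liftable_at:
  fixes q :: "'i::finite \<Rightarrow> nat"
  assumes p: "prime p" and ij: "i \<noteq> j" and gcd: "1 < gcd (exponent q i) (exponent q j)"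
  shows "\<exists>Y\<in>proj_space_rat. nonzero_coords Y \<and> \<not> liftable_at q p Y"
proof -
  define y :: "rat ^ 'i" where "y = (\<chi> k. if k = i then of_nat p else 1)"
  have y: "\<forall>k. y $ k \<noteq> 0"
    using p by (auto simp: y_def)
  have "\<not> [rat_valuation p (y $ i) = rat_valuation p (y $ j)]
          (mod int (gcd (exponent q i) (exponent q j)))"
    using ij gcd rat_valuation_self[OF p] by (simp add: y_def cong_0_iff del: int_dvd_int_iff)
  then have "\<not> liftable_at q p (proj_rel `` {y})"
    unfolding liftable_at_class[OF p y] by blast
  moreover have "proj_rel `` {y} \<in> proj_space_rat"
    unfolding proj_space_rat_def using y by (intro quotientI) auto
  moreover have "nonzero_coords (proj_rel `` {y})"
    using y by (auto simp: nonzero_coords_def proj_rel_def)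
  ultimately show ?thesis
    by blast
qed

theorem lemma6:
  fixes q :: "'i::finite \<Rightarrow> nat"
  assumes "\<forall>i. 0 < q i"
    and "well_formed q"
    and "2 \<le> weights_lcm q"
  shows "(\<forall>l. prime l \<and> l dvd weights_lcm q \<longrightarrow>
            (\<exists>i j. i \<noteq> j \<and> l dvd gcd (exponent q i) (exponent q j))) \<and>
         \<not> pairwise (\<lambda>i j. coprime (exponent q i) (exponent q j)) UNIV \<and>
         wproj_to_proj q ` wproj_space_rat q \<noteq> proj_space_rat \<and>
         (\<forall>p. prime p \<longrightarrow>
            (\<exists>i j. i \<noteq> j \<and> 1 < gcd (exponent q i) (exponent q j)) \<and>
            (\<exists>Y\<in>proj_space_rat. nonzero_coords Y \<and> \<not> liftable_at q p Y))"
proof -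
  obtain l where l: "prime l" "l dvd weights_lcm q"
    using assms(3) prime_factor_nat[of "weights_lcm q"] by auto
  obtain i j where ij: "i \<noteq> j" "l dvd gcd (exponent q i) (exponent q j)"
    using prime_dvd_gcd_exponents[OF assms(2) l] .
  \<comment> \<open>Excludes gcd 0, which \<open>l\<close> would divide without giving
    \<open>l \<le> 0\<close>.\<close>
  have "0 < gcd (exponent q i) (exponent q j)"
    using exponent_pos[OF assms(1)] by simp
  then have gcd: "1 < gcd (exponent q i) (exponent q j)"
    using less_le_trans[OF prime_gt_1_nat[OF l(1)] dvd_imp_le[OF ij(2)]] by simp
  then have "\<not> coprime (exponent q i) (exponent q j)"
    by (auto simp: coprime_iff_gcd_eq_1)
  then have "\<not> pairwise (\<lambda>i j. coprime (exponent q i) (exponent q j)) UNIV"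
    using ij(1) by (auto simp: pairwise_def)
  moreover have "wproj_to_proj q ` wproj_space_rat q \<noteq> proj_space_rat"
  proof
    assume surj: "wproj_to_proj q ` wproj_space_rat q = proj_space_rat"
    \<comment> \<open>Any prime would do in place of 2.\<close>
    obtain Y where Y: "Y \<in> proj_space_rat" "nonzero_coords Y" "\<not> liftable_at q 2 Y"
      using exists_not_liftable_at[OF two_is_prime_nat ij(1) gcd] by auto
    then obtain P where "P \<in> wproj_space_rat q" "Y = wproj_to_proj q P"
      using surj by auto
    then show False
      using liftable_at_wproj_to_proj[OF assms(1) two_is_prime_nat] Y by simp
  qed
  \<comment> \<open>Now for every prime divisor, not only the one fixed above; \<open>i\<close> and
    \<open>j\<close> may depend on it.\<close>
  moreover have "\<exists>i j. i \<noteq> j \<and> l dvd gcd (exponent q i) (exponent q j)"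
    if "prime l" "l dvd weights_lcm q" for l
    using prime_dvd_gcd_exponents[OF assms(2) that] by metis
  ultimately show ?thesis
    using exists_not_liftable_at[OF _ ij(1) gcd] ij(1) gcd by blast
qed

end
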